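(* Let $G$ be the grid defined in the context. For every $i\ge0$, the set $\{[G(i,j)]_3 : j\ge0\}$ of base-3 values of the strings in row $i$ equals the set of terms of the sequence $S_i$, the $i$-th sequence of the greedy partition of the non-negative integers into 3-free sequences.
   Context: For a finite string $w=a_na_{n-1}\cdots a_0$ over digits $\{0,1,2\}$ let $[w]_{3/2}=\sum_k a_k(3/2)^k$ and $[w]_3=\sum_k a_k3^k$. Define an operation $T$ on such strings ("adding 2 in base $\frac32$"): if $w$ contains no digit $0$, first replace $w$ by $0w$; then change the rightmost $0$ of $w$ into $2$, change every digit to the right of it by $1\mapsto0$, $2\mapsto1$, and leave all digits to the left of it unchanged. Then $[T(w)]_{3/2}=[w]_{3/2}+2$. The grid $G$ has entries $G(i,j)$ (row $i$, column $j$, $i,j\ge0$): $G(0,j)$ is the binary representation of $j$ (so row $0$ is $0,1,10,11,100,\dots$), and $G(i+1,j)=T(G(i,j))$. A sequence of integers is 3-free if it contains no three distinct terms $x<y<z$ with $y-x=z-y$. $S_0$ is the lexicographically earliest 3-free sequence of non-negative integers: increasing, starting with $0$, each next term the smallest integer larger than the previous one creating no 3-term arithmetic progression with earlier terms. For $n\ge1$, $S_n$ is the lexicographically earliest increasing 3-free sequence of non-negative integers not used in any $S_i$, $i<n$: it starts with the smallest non-negative integer not in $\bigcup_{i<n}S_i$, and each next term is the smallest integer larger than the previous term, not in $\bigcup_{i<n}S_i$, creating no 3-term arithmetic progression with earlier terms of $S_n$. *)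

theory Defs
  imports Complex_Main
begin

text \<open>
  A string \<open>a\<^sub>n \<dots> a\<^sub>0\<close> is the list \<open>[a\<^sub>0, \<dots>, a\<^sub>n]\<close>: the least significant (rightmost) digit comes first,
  so a leading zero is appended at the end of the list.
\<close>

definition base_value :: "'a::comm_semiring_1 \<Rightarrow> nat list \<Rightarrow> 'a" where
  "base_value b w = (\<Sum>k<length w. of_nat (w ! k) * b ^ k)"

definition pad_zero :: "nat list \<Rightarrow> nat list" where
  "pad_zero w = (if 0 \<in> set w then w else w @ [0])"

definition add_two :: "nat list \<Rightarrow> nat list" where
  "add_two w =
     (let v = pad_zero w
      in map (\<lambda>d. d - 1) (takeWhile (\<lambda>d. d \<noteq> 0) v) @ 2 # tl (dropWhile (\<lambda>d. d \<noteq> 0) v))"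

fun binary_rep :: "nat \<Rightarrow> nat list" where
  "binary_rep j = (if j < 2 then [j] else (j mod 2) # binary_rep (j div 2))"

declare binary_rep.simps [simp del]

fun grid :: "nat \<Rightarrow> nat \<Rightarrow> nat list" where
  "grid 0 j = binary_rep j"
| "grid (Suc i) j = add_two (grid i j)"

definition three_free :: "nat set \<Rightarrow> bool" where
  "three_free A \<longleftrightarrow> \<not> (\<exists>x\<in>A. \<exists>y\<in>A. \<exists>z\<in>A. x < y \<and> y < z \<and> y - x = z - y)"

text \<open>
  \<open>greedy_seq U k\<close> is the term with index \<open>k\<close> of the greedy increasing 3-free sequence avoiding \<open>U\<close>.
  \<open>LEAST\<close> is unspecified when no admissible integer exists; this does not occur for the sets \<open>U\<close>
  arising in \<open>S\<close>.
\<close>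

fun greedy_seq :: "nat set \<Rightarrow> nat \<Rightarrow> nat" where
  "greedy_seq U k =
     (let P = greedy_seq U ` {..<k}
      in LEAST x. x \<notin> U \<and> (\<forall>p\<in>P. p < x) \<and> three_free (insert x P))"

declare greedy_seq.simps [simp del]

fun S :: "nat \<Rightarrow> nat \<Rightarrow> nat" where
  "S n = greedy_seq (\<Union>i\<in>{..<n}. range (S i))"

declare S.simps [simp del]

end

theory Submission
  imports Defs "HOL-Library.Infinite_Set"
begin

text \<open>
  Read in base 3, adding 2 in base \<open>3/2\<close> becomes an injective map \<open>step\<close> on the natural numbers:
  the last digit runs through the cycle \<open>0, 2, 1\<close>, and \<open>step\<close> is passed on to the remaining digits
  unless the last digit is 0. Hence \<open>step\<close> iterated \<open>3p\<close> times fixes the last digit and iterates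
  \<open>step\<close> exactly \<open>2p\<close> times on the other digits, so each row is a union of two sets \<open>3R + d\<close> where
  \<open>R\<close> is another row. In an arithmetic progression the last digits are all equal or all distinct;
  as a row uses only two last digits, descent shows that it is 3-free. A number in a row after
  row \<open>i\<close> is the last term of a progression whose first two terms are in row \<open>i\<close>; because of
  carries, the induction on this number has to treat two further linear relations simultaneously.
\<close>

section \<open>Adding 2 in base 3/2 as a map on base-3 values\<close>

fun step :: "nat \<Rightarrow> nat" where
  "step n = (if n mod 3 = 0 then n + 2 else 3 * step (n div 3) + (n mod 3 - 1))"

declare step.simps [simp del]

lemma step_digit [simp]:
  "step (3 * a) = 3 * a + 2"
  "step (3 * a + 1) = 3 * step a"
  "step (Suc (3 * a)) = 3 * step a"
  "step (3 * a + 2) = 3 * step a + 1"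
  "step (Suc (Suc (3 * a))) = 3 * step a + 1"
proof -
  have "(3 * a + 1) div 3 = a" "(3 * a + 1) mod 3 = 1" "(3 * a + 2) div 3 = a" "(3 * a + 2) mod 3 = 2"
    by presburger+
  then show "step (3 * a) = 3 * a + 2" "step (3 * a + 1) = 3 * step a"
    "step (Suc (3 * a)) = 3 * step a" "step (3 * a + 2) = 3 * step a + 1"
    "step (Suc (Suc (3 * a))) = 3 * step a + 1"
    using step.simps[of "3 * a"] step.simps[of "3 * a + 1"] step.simps[of "3 * a + 2"] by simp_all
qed

lemma base3_cases:
  fixes n :: nat
  obtains a where "n = 3 * a" | a where "n = 3 * a + 1" | a where "n = 3 * a + 2"
proof -
  have "n = 3 * (n div 3) \<or> n = 3 * (n div 3) + 1 \<or> n = 3 * (n div 3) + 2"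
    by presburger
  with that show thesis by blast
qed

text \<open>The cycle permutes the last digits, so equal values have equal last digits; the higher
  digits are unchanged for digit 0 and covered by induction otherwise.\<close>

lemma step_eqD: "step m = step n \<Longrightarrow> m = n"
proof (induction m arbitrary: n rule: less_induct)
  case (less m)
  show ?case
  proof (cases m rule: base3_cases)
    case (1 a)
    then show ?thesis
      using less.prems by (cases n rule: base3_cases) (simp_all; presburger)+
  next
    case (2 a)
    with less.prems obtain b where "n = 3 * b + 1" "step a = step b"
      by (cases n rule: base3_cases) (simp_all; presburger)+
    with less.IH[of a b] 2 show ?thesis by simp
  next
    case (3 a)
    with less.prems obtain b where "n = 3 * b + 2" "step a = step b"
      by (cases n rule: base3_cases) (simp_all; presburger)+
    with less.IH[of a b] 3 show ?thesis by simp
  qed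
qed

lemma inj_step_power: "inj (step ^^ i)"
proof -
  have "inj step" by (rule injI) (rule step_eqD)
  then show ?thesis by (rule inj_fn)
qed

text \<open>Three successive steps meet each last digit once, and only digit 0 stops the
  carry.\<close>

lemma step_power_3:
  "(step ^^ (3 * p)) (3 * a) = 3 * (step ^^ (2 * p)) a"
  "(step ^^ (3 * p)) (3 * a + 1) = 3 * (step ^^ (2 * p)) a + 1"
  "(step ^^ (3 * p)) (3 * a + 2) = 3 * (step ^^ (2 * p)) a + 2"
proof (induction p)
  case (Suc p)
  have eq: "3 * Suc p = Suc (Suc (Suc (3 * p)))" "2 * Suc p = Suc (Suc (2 * p))" by simp_all
  from Suc show
    "(step ^^ (3 * Suc p)) (3 * a) = 3 * (step ^^ (2 * Suc p)) a"
    "(step ^^ (3 * Suc p)) (3 * a + 1) = 3 * (step ^^ (2 * Suc p)) a + 1"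
    "(step ^^ (3 * Suc p)) (3 * a + 2) = 3 * (step ^^ (2 * Suc p)) a + 2"
    unfolding eq by simp_all
qed simp_all

section \<open>Base-3 values of the grid\<close>

lemma base_value_Cons:
  "base_value b (d # w) = of_nat d + b * base_value b w"
  by (simp add: base_value_def sum.lessThan_Suc_shift sum_distrib_left mult_ac del: sum.lessThan_Suc)

lemma add_two_Nil: "add_two [] = [2]"
  by (simp add: add_two_def pad_zero_def)

text \<open>The rightmost 0 is searched from the head of the list, which gives the same recursion as
  \<open>step\<close>.\<close>

lemma add_two_Cons: "add_two (d # w) = (if d = 0 then 2 # w else (d - 1) # add_two w)"
  by (auto simp: add_two_def pad_zero_def Let_def)

text \<open>The digit bound makes the head of the list the last base-3 digit of the value; it is
  preserved, as the grid iterates \<open>add_two\<close>.\<close>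

lemma add_two_step:
  assumes "set w \<subseteq> {..<3}"
  shows "set (add_two w) \<subseteq> {..<3} \<and> base_value 3 (add_two w) = step (base_value 3 w)"
  using assms
proof (induction w)
  case Nil
  then show ?case
    using step_digit(1)[of 0] by (simp add: add_two_Nil base_value_def)
next
  case (Cons d w)
  then have "d = 0 \<or> d = 1 \<or> d = 2" by auto
  with Cons show ?case
    by (auto simp: add_two_Cons base_value_Cons)
qed

lemma binary_rep_digits: "set (binary_rep j) \<subseteq> {..<2}"
  by (induction j rule: binary_rep.induct) (subst binary_rep.simps, auto)

text \<open>The Stanley sequence 0, 1, 3, 4, 9, ... of numbers with base-3 digits 0 and 1
  only.\<close>

definition stanley :: "nat \<Rightarrow> nat" where
  "stanley j = base_value 3 (binary_rep j)"

lemma stanley_0: "stanley 0 = 0"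
  by (simp add: stanley_def binary_rep.simps base_value_def)

lemma stanley_digit:
  assumes "e < 2"
  shows "stanley (2 * j + e) = 3 * stanley j + e"
proof (cases "j = 0")
  case True
  then show ?thesis
    using assms by (simp add: stanley_def binary_rep.simps base_value_def)
next
  case False
  with assms have "binary_rep (2 * j + e) = e # binary_rep j"
    by (subst binary_rep.simps) auto
  then show ?thesis by (simp add: stanley_def base_value_Cons)
qed

lemma base_value_grid:
  "set (grid i j) \<subseteq> {..<3} \<and> base_value 3 (grid i j) = (step ^^ i) (stanley j)"
proof (induction i)
  case 0
  then show ?case
    using binary_rep_digits[of j] by (auto simp: stanley_def)
next
  case (Suc i)
  then show ?case using add_two_step by simp
qed

section \<open>Recursive structure of the rows\<close>

definition row :: "nat \<Rightarrow> nat set" where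
  "row i = (step ^^ i) ` range stanley"

text \<open>A range rather than a union of rows, so that \<open>step_power_3\<close> applies
  directly; by \<open>notin_earlier_rows_iff\<close> it is the complement of the rows before
  \<open>i\<close>.\<close>

definition rows_from :: "nat \<Rightarrow> nat set" where
  "rows_from i = range (step ^^ i)"

lemma row_0_iff: "n \<in> row 0 \<longleftrightarrow> (\<exists>a\<in>row 0. n = 3 * a \<or> n = 3 * a + 1)"
proof
  assume "n \<in> row 0"
  then obtain j where j: "n = stanley j" by (auto simp: row_def)
  have "n = 3 * stanley (j div 2) + j mod 2"
    using stanley_digit[of "j mod 2" "j div 2"] j by simp
  then show "\<exists>a\<in>row 0. n = 3 * a \<or> n = 3 * a + 1"
    by (force simp: row_def mod2_eq_if split: if_splits)
next
  assume "\<exists>a\<in>row 0. n = 3 * a \<or> n = 3 * a + 1"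
  then obtain j where "n = 3 * stanley j \<or> n = 3 * stanley j + 1" by (auto simp: row_def)
  then have "n = stanley (2 * j) \<or> n = stanley (2 * j + 1)"
    using stanley_digit[of 0 j] stanley_digit[of 1 j] by simp
  then show "n \<in> row 0" by (auto simp: row_def)
qed

lemma row_alt: "row i = (step ^^ i) ` row 0"
  by (simp add: row_def)

lemma row_Suc: "row (Suc i) = step ` row i"
  by (simp add: row_def image_comp)

lemma rows_from_Suc: "rows_from (Suc i) = step ` rows_from i"
  by (auto simp: rows_from_def)

text \<open>\<open>step_power_3\<close> keeps the last digits 0 and 1 of row 0. One and two further
  steps turn this pair into 2, 0 and then 1, 2; only in the middle case do the halves come from
  different rows, because digit 0 has not carried yet.\<close>

lemma row_3: "row (3 * p) = (\<lambda>a. 3 * a) ` row (2 * p) \<union> (\<lambda>a. 3 * a + 1) ` row (2 * p)"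
proof -
  have "row 0 = (\<lambda>a. 3 * a) ` row 0 \<union> (\<lambda>a. 3 * a + 1) ` row 0"
    using row_0_iff by blast
  then have "row (3 * p) = (step ^^ (3 * p)) ` ((\<lambda>a. 3 * a) ` row 0 \<union> (\<lambda>a. 3 * a + 1) ` row 0)"
    using row_alt by metis
  also have "\<dots> = (\<lambda>a. 3 * a) ` row (2 * p) \<union> (\<lambda>a. 3 * a + 1) ` row (2 * p)"
    unfolding row_alt[of "2 * p"] image_Un image_image step_power_3 ..
  finally show ?thesis .
qed

lemma row_3_1: "row (3 * p + 1) = (\<lambda>a. 3 * a + 2) ` row (2 * p) \<union> (\<lambda>a. 3 * a) ` row (2 * p + 1)"
  unfolding add_Suc_right Suc_eq_plus1[symmetric] row_Suc row_3 image_Un image_image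
  by simp

lemma row_3_2: "row (3 * p + 2) = (\<lambda>a. 3 * a + 1) ` row (2 * p + 1) \<union> (\<lambda>a. 3 * a + 2) ` row (2 * p + 1)"
proof -
  have "row (3 * p + 2) = step ` row (3 * p + 1)"
    by (simp flip: row_Suc)
  also have "\<dots> = (\<lambda>a. 3 * step a + 1) ` row (2 * p) \<union> (\<lambda>a. 3 * a + 2) ` row (2 * p + 1)"
    unfolding row_3_1 image_Un image_image step_digit ..
  also have "(\<lambda>a. 3 * step a + 1) ` row (2 * p) = (\<lambda>a. 3 * a + 1) ` row (2 * p + 1)"
    by (simp add: row_Suc image_image)
  finally show ?thesis .
qed

lemma rows_from_3:
  assumes "n \<in> rows_from (3 * p)"
  obtains a where "a \<in> rows_from (2 * p)" "n = 3 * a \<or> n = 3 * a + 1 \<or> n = 3 * a + 2"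
proof -
  obtain m where m: "n = (step ^^ (3 * p)) m"
    using assms by (auto simp: rows_from_def)
  show thesis
    by (cases m rule: base3_cases; rule that[of "(step ^^ (2 * p)) _"])
      (use m step_power_3[of p] in \<open>auto simp: rows_from_def\<close>)
qed

lemma rows_from_3_1:
  assumes "n \<in> rows_from (3 * p + 1)"
  obtains a where "a \<in> rows_from (2 * p)" "n = 3 * a + 2"
  | a where "a \<in> rows_from (2 * p + 1)" "n = 3 * a \<or> n = 3 * a + 1"
proof -
  obtain m where "m \<in> rows_from (3 * p)" and n: "n = step m"
    using assms by (auto simp: rows_from_Suc)
  then obtain a where a: "a \<in> rows_from (2 * p)" and "m = 3 * a \<or> m = 3 * a + 1 \<or> m = 3 * a + 2"
    using rows_from_3 by blast
  then have "n = 3 * a + 2 \<or> n = 3 * step a \<or> n = 3 * step a + 1"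
    using n by auto
  moreover have "step a \<in> rows_from (2 * p + 1)"
    using a by (simp add: rows_from_Suc)
  ultimately show thesis using that a by blast
qed

lemma rows_from_3_2:
  assumes "n \<in> rows_from (3 * p + 2)"
  obtains a where "a \<in> rows_from (2 * p + 1)" "n = 3 * a + 1 \<or> n = 3 * a + 2"
  | a where "a \<in> rows_from (2 * p + 2)" "n = 3 * a"
proof -
  obtain m where "m \<in> rows_from (3 * p + 1)" and n: "n = step m"
    using assms by (auto simp: rows_from_Suc)
  then show thesis
  proof (cases rule: rows_from_3_1)
    case (1 a)
    moreover from this have "step a \<in> rows_from (2 * p + 1)"
      by (simp add: rows_from_Suc)
    ultimately show thesis using that(1)[of "step a"] n by simp
  next
    case (2 a)
    then have "step a \<in> rows_from (2 * p + 2)"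
      by (simp add: rows_from_Suc)
    then show thesis using that(1)[of a] that(2)[of "step a"] n 2 by auto
  qed
qed

section \<open>The partition into rows\<close>

text \<open>A last digit 2 arises from 0 by one step. For a last digit 0 or 1, both alternatives are
  inherited from the higher digits; 0 itself is in row 0.\<close>

lemma row_0_or_step: "n \<in> row 0 \<or> n \<in> range step"
proof (induction n rule: less_induct)
  case (less n)
  show ?case
  proof (cases n rule: base3_cases)
    case (1 a)
    show ?thesis
    proof (cases "a = 0")
      case True
      then show ?thesis using 1 stanley_0 by (force simp: row_def)
    next
      case False
      then have "a \<in> row 0 \<or> a \<in> range step" using less 1 by simp
      then show ?thesis
        using 1 row_0_iff[of n] step_digit(2) by (metis rangeE rangeI)
    qed
  next
    case (2 a)
    then have "a \<in> row 0 \<or> a \<in> range step" using less by simp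
    then show ?thesis
      using 2 row_0_iff[of n] step_digit(4) by (metis rangeE rangeI)
  next
    case (3 a)
    then show ?thesis by (metis rangeI step_digit(1))
  qed
qed

text \<open>Every value of \<open>step\<close> contains the base-3 digit 2 that replaced a
  0.\<close>

lemma step_notin_row_0: "step m \<notin> row 0"
proof (induction m rule: less_induct)
  case (less m)
  show ?case
  proof
    assume "step m \<in> row 0"
    then obtain a where a: "a \<in> row 0" "step m = 3 * a \<or> step m = 3 * a + 1"
      using row_0_iff[of "step m"] by blast
    show False
    proof (cases m rule: base3_cases)
      case (1 b)
      with a(2) have "3 * b + 2 = 3 * a \<or> 3 * b + 2 = 3 * a + 1" by simp
      then show False by presburger
    next
      case (2 b)
      with a(2) have "3 * step b = 3 * a \<or> 3 * step b = 3 * a + 1" by simp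
      then have "a = step b" by presburger
      with less[of b] 2 a show False by simp
    next
      case (3 b)
      with a(2) have "3 * step b + 1 = 3 * a \<or> 3 * step b + 1 = 3 * a + 1" by simp
      then have "a = step b" by presburger
      with less[of b] 3 a show False by simp
    qed
  qed
qed

lemma rows_from_split: "n \<in> rows_from i \<Longrightarrow> n \<in> row i \<or> n \<in> rows_from (Suc i)"
  using row_0_or_step unfolding rows_from_def row_alt[of i] by (force simp: funpow_swap1)

lemma row_subset_rows_from: "row i \<subseteq> rows_from i"
  by (auto simp: row_def rows_from_def)

lemma row_disjoint: "row i \<inter> rows_from (Suc i) = {}"
proof -
  have "False" if "(step ^^ i) a = (step ^^ i) (step b)" "a \<in> row 0" for a b
    using that step_notin_row_0 injD[OF inj_step_power] by blast
  then show ?thesis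
    unfolding rows_from_def row_alt[of i] by (force simp: funpow_swap1)
qed

lemma rows_from_antimono: "i \<le> k \<Longrightarrow> rows_from k \<subseteq> rows_from i"
  by (auto simp: rows_from_def dest!: le_Suc_ex) (auto simp: funpow_add)

text \<open>Iterating \<open>rows_from_split\<close> strips off one row at a time. What remains is
  what the greedy sequence with index \<open>i\<close> may use.\<close>

lemma notin_earlier_rows_iff: "n \<notin> (\<Union>k<i. row k) \<longleftrightarrow> n \<in> rows_from i"
proof
  show "n \<notin> (\<Union>k<i. row k) \<Longrightarrow> n \<in> rows_from i"
  proof (induction i)
    case 0
    then show ?case by (simp add: rows_from_def)
  next
    case (Suc i)
    then show ?case using rows_from_split by (auto simp: lessThan_Suc)
  qed
  show "n \<in> rows_from i \<Longrightarrow> n \<notin> (\<Union>k<i. row k)"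
    using row_disjoint rows_from_antimono[OF Suc_leI] by fastforce
qed

section \<open>Progressions in the rows\<close>

lemma row_digits:
  obtains d e k l where "d < 3" "e < 3" "d \<noteq> e"
    "row i = (\<lambda>a. 3 * a + d) ` row k \<union> (\<lambda>a. 3 * a + e) ` row l"
proof (cases i rule: base3_cases)
  case (1 p)
  with row_3[of p] show thesis by (intro that[of 0 1]) auto
next
  case (2 p)
  with row_3_1[of p] show thesis by (intro that[of 2 0]) auto
next
  case (3 p)
  with row_3_2[of p] show thesis by (intro that[of 1 2]) auto
qed

lemma row_no_progression:
  assumes "x \<in> row i" "y \<in> row i" "z \<in> row i" "x < y"
  shows "x + z \<noteq> 2 * y"
  using assms
proof (induction z arbitrary: i x y rule: less_induct)
  case (less z)
  show ?case
  proof
    assume eq: "x + z = 2 * y"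
    obtain d e k l where de: "d < 3" "e < 3" "d \<noteq> e"
      and row: "row i = (\<lambda>a. 3 * a + d) ` row k \<union> (\<lambda>a. 3 * a + e) ` row l"
      by (rule row_digits)
    have digit: "\<exists>a f. u = 3 * a + f \<and> (f = d \<and> a \<in> row k \<or> f = e \<and> a \<in> row l)"
      if "u \<in> row i" for u
      using that unfolding row by blast
    obtain a f where x: "x = 3 * a + f" "f = d \<and> a \<in> row k \<or> f = e \<and> a \<in> row l"
      using digit less.prems(1) by blast
    obtain b g where y: "y = 3 * b + g" "g = d \<and> b \<in> row k \<or> g = e \<and> b \<in> row l"
      using digit less.prems(2) by blast
    obtain c h where z: "z = 3 * c + h" "h = d \<and> c \<in> row k \<or> h = e \<and> c \<in> row l"
      using digit less.prems(3) by blast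
    have "3 * a + f + (3 * c + h) = 2 * (3 * b + g)"
      using eq x y z by simp
    moreover have "f < 3" "g < 3" "h < 3" using x y z de by auto
    moreover have "f = g \<or> f = h \<or> g = h" using x y z by blast
    \<comment> \<open>The equation makes \<open>f + g + h\<close> divisible by 3, so two equal
      digits force the third.\<close>
    ultimately have "f = g \<and> h = g" by (elim disjE) presburger+
    then have same: "f = g" "h = g" by auto
    then have "a < b" "a + c = 2 * b" "c < z"
      using x y z eq less.prems(4) by auto
    moreover have "a \<in> row k \<and> b \<in> row k \<and> c \<in> row k \<or> a \<in> row l \<and> b \<in> row l \<and> c \<in> row l"
      using same x y z de by auto
    ultimately show False using less.IH by blast
  qed
qed

lemma three_free_row: "three_free (row i)"
  unfolding three_free_def
proof
  assume "\<exists>x\<in>row i. \<exists>y\<in>row i. \<exists>z\<in>row i. x < y \<and> y < z \<and> y - x = z - y"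
  then obtain x y z where "x \<in> row i" "y \<in> row i" "z \<in> row i" "x < y" "y < z" "y - x = z - y"
    by blast
  moreover from this have "x + z = 2 * y" by linarith
  ultimately show False using row_no_progression by blast
qed

section \<open>Progressions ending in later rows\<close>

definition closes :: "nat \<Rightarrow> nat \<Rightarrow> bool" where
  "closes j n \<longleftrightarrow> (\<exists>x\<in>row j. \<exists>y\<in>row j. x + n = 2 * y \<and> y < n)"

text \<open>\<open>y\<close> is half a unit below the midpoint of \<open>x\<close> and
  \<open>n\<close>; a carry in \<open>closes_above\<close> leads to this relation.
  \<open>x = y\<close> may occur.\<close>

definition closes_below :: "nat \<Rightarrow> nat \<Rightarrow> bool" where
  "closes_below j n \<longleftrightarrow> (\<exists>x\<in>row j. \<exists>y\<in>row j. x + n = 2 * y + 1 \<and> y < n)"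

text \<open>\<open>y\<close> is half a unit above the midpoint. It comes from the next row because
  row \<open>3 * p + 1\<close> attaches the digits 2 and 0 to the rows \<open>2 * p\<close> and
  \<open>2 * p + 1\<close>. \<open>y = n\<close> may occur, as \<open>n\<close> can lie in row
  \<open>Suc j\<close>.\<close>

definition closes_above :: "nat \<Rightarrow> nat \<Rightarrow> bool" where
  "closes_above j n \<longleftrightarrow> (\<exists>x\<in>row j. \<exists>y\<in>row (Suc j). x + n + 1 = 2 * y \<and> y \<le> n)"

lemma closesI: "\<lbrakk>x \<in> row j; y \<in> row j; x + n = 2 * y; y < n\<rbrakk> \<Longrightarrow> closes j n"
  unfolding closes_def by blast

lemma closes_belowI: "\<lbrakk>x \<in> row j; y \<in> row j; x + n = 2 * y + 1; y < n\<rbrakk> \<Longrightarrow> closes_below j n"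
  unfolding closes_below_def by blast

lemma closes_aboveI: "\<lbrakk>x \<in> row j; y \<in> row (Suc j); x + n + 1 = 2 * y; y \<le> n\<rbrakk> \<Longrightarrow> closes_above j n"
  unfolding closes_above_def by blast

lemma rowI:
  "a \<in> row (2 * p) \<Longrightarrow> 3 * a \<in> row (3 * p)"
  "a \<in> row (2 * p) \<Longrightarrow> 3 * a + 1 \<in> row (3 * p)"
  "a \<in> row (2 * p) \<Longrightarrow> 3 * a + 2 \<in> row (3 * p + 1)"
  "a \<in> row (2 * p + 1) \<Longrightarrow> 3 * a \<in> row (3 * p + 1)"
  "a \<in> row (2 * p + 1) \<Longrightarrow> 3 * a + 1 \<in> row (3 * p + 2)"
  "a \<in> row (2 * p + 1) \<Longrightarrow> 3 * a + 2 \<in> row (3 * p + 2)"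
  "a \<in> row (2 * p + 2) \<Longrightarrow> 3 * a \<in> row (3 * p + 3)"
  "a \<in> row (2 * p + 2) \<Longrightarrow> 3 * a + 1 \<in> row (3 * p + 3)"
  using row_3[of p] row_3_1[of p] row_3_2[of p] row_3[of "p + 1", unfolded distrib_left mult_1_right] by auto

text \<open>Ensures that \<open>n div 3 < n\<close> in the descent on numbers of later rows.\<close>

lemma zero_notin_rows_from: "0 \<notin> rows_from (Suc i)"
proof -
  have "0 \<in> row 0" using stanley_0 by (force simp: row_def)
  then have "0 \<notin> rows_from 1" using row_disjoint[of 0] by auto
  then show ?thesis using rows_from_antimono[of 1 "Suc i"] by auto
qed

text \<open>The last digits of \<open>x\<close> and \<open>y\<close> are chosen from those available
  in their rows so that each relation for \<open>n\<close> reduces to one of the three for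
  \<open>n div 3\<close>, except where witnesses are given directly.\<close>

lemma rows_from_closes:
  assumes "n \<in> rows_from (Suc j)"
  shows "closes j n \<and> closes_below j n \<and> closes_above j n"
  using assms
proof (induction n arbitrary: j rule: less_induct)
  case (less n)
  have "n \<noteq> 0" using less.prems zero_notin_rows_from by metis
  then have smaller: "a < n" if "n = 3 * a \<or> n = 3 * a + 1 \<or> n = 3 * a + 2" for a
    using that by auto
  note IH = less.IH[OF smaller]
  have mono: "a \<in> rows_from (2 * p + 2) \<Longrightarrow> a \<in> rows_from (2 * p + 1)" for a p
    using rows_from_antimono[of "2 * p + 1" "2 * p + 2"] by auto
  show ?case
  proof (cases j rule: base3_cases)
    case j: (1 p)
    have rows: "n \<in> rows_from (3 * p + 1)" using less.prems j by simp
    have step_IH: ?thesis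
      if "a \<in> rows_from (2 * p + 1)" "n = 3 * a \<or> n = 3 * a + 1 \<or> n = 3 * a + 2" for a
    proof -
      have "closes (2 * p) a" "closes_below (2 * p) a" "closes_above (2 * p) a"
        using IH[of a "2 * p"] that by auto
      then obtain x y u v s t where
        A: "x \<in> row (2 * p)" "y \<in> row (2 * p)" "x + a = 2 * y" "y < a" and
        B: "u \<in> row (2 * p)" "v \<in> row (2 * p)" "u + a = 2 * v + 1" "v < a" and
        D: "s \<in> row (2 * p)" "t \<in> row (2 * p + 1)" "s + a + 1 = 2 * t" "t \<le> a"
        unfolding closes_def closes_below_def closes_above_def by auto
      from that(2) show ?thesis
      proof (elim disjE)
        assume n: "n = 3 * a"
        have "closes j n"
          using rowI(1)[OF A(1)] rowI(1)[OF A(2)] A(3,4) n j by (intro closesI[of "3 * x" _ "3 * y"]) auto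
        moreover have "closes_below j n"
          using rowI(2)[OF A(1)] rowI(1)[OF A(2)] A(3,4) n j
          by (intro closes_belowI[of "3 * x + 1" _ "3 * y"]) auto
        \<comment> \<open>With last digits 0, 2, 0 the sum \<open>0 + 0 + 1\<close> falls short of
          \<open>2 * 2\<close> by 3; this carry leaves \<open>closes_below\<close> for
          \<open>a\<close>.\<close>
        moreover have "closes_above j n"
          using rowI(1)[OF B(1)] rowI(3)[OF B(2)] B(3,4) n j
          by (intro closes_aboveI[of "3 * u" _ "3 * v + 2"]) auto
        ultimately show ?thesis by blast
      next
        assume n: "n = 3 * a + 1"
        have "closes j n"
          using rowI(2)[OF A(1)] rowI(2)[OF A(2)] A(3,4) n j
          by (intro closesI[of "3 * x + 1" _ "3 * y + 1"]) auto
        moreover have "closes_below j n"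
          using rowI(1)[OF A(1)] rowI(1)[OF A(2)] A(3,4) n j
          by (intro closes_belowI[of "3 * x" _ "3 * y"]) auto
        moreover have "closes_above j n"
          using rowI(2)[OF D(1)] rowI(4)[OF D(2)] D(3,4) n j
          by (intro closes_aboveI[of "3 * s + 1" _ "3 * t"]) auto
        ultimately show ?thesis by blast
      next
        assume n: "n = 3 * a + 2"
        have "closes j n"
          using rowI(1)[OF A(1)] rowI(2)[OF A(2)] A(3,4) n j
          by (intro closesI[of "3 * x" _ "3 * y + 1"]) auto
        moreover have "closes_below j n"
          using rowI(2)[OF A(1)] rowI(2)[OF A(2)] A(3,4) n j
          by (intro closes_belowI[of "3 * x + 1" _ "3 * y + 1"]) auto
        moreover have "closes_above j n"
          using rowI(2)[OF A(1)] rowI(3)[OF A(2)] A(3,4) n j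
          by (intro closes_aboveI[of "3 * x + 1" _ "3 * y + 2"]) auto
        ultimately show ?thesis by blast
      qed
    qed
    from rows show ?thesis
    proof (cases rule: rows_from_3_1)
      case (1 a)
      show ?thesis
      \<comment> \<open>The induction hypothesis at index \<open>2 * p\<close> does not reach
        \<open>a\<close> in \<open>row (2 * p)\<close>, but then \<open>3 * a\<close>,
        \<open>3 * a + 1\<close> and \<open>n\<close> itself serve as witnesses.\<close>
      proof (cases "a \<in> row (2 * p)")
        case True
        have "closes j n"
          using rowI(1,2)[OF True] 1 j by (intro closesI[of "3 * a" _ "3 * a + 1"]) auto
        moreover have "closes_below j n"
          using rowI(2)[OF True] 1 j by (intro closes_belowI[of "3 * a + 1" _ "3 * a + 1"]) auto
        moreover have "closes_above j n"
          using rowI(2,3)[OF True] 1 j by (intro closes_aboveI[of "3 * a + 1" _ "3 * a + 2"]) auto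
        ultimately show ?thesis by blast
      next
        case False
        then have "a \<in> rows_from (2 * p + 1)" using 1 rows_from_split by auto
        then show ?thesis using step_IH 1 by blast
      qed
    next
      case (2 a)
      then show ?thesis using step_IH by blast
    qed
  next
    case j: (2 p)
    have rows: "n \<in> rows_from (3 * p + 2)" using less.prems j by simp
    have IH_below: "\<exists>x\<in>row (2 * p). \<exists>y\<in>row (2 * p). x + a = 2 * y \<and> y < a"
      "\<exists>x\<in>row (2 * p). \<exists>y\<in>row (2 * p). x + a = 2 * y + 1 \<and> y < a"
      "\<exists>x\<in>row (2 * p). \<exists>y\<in>row (2 * p + 1). x + a + 1 = 2 * y \<and> y \<le> a"
      if "a \<in> rows_from (2 * p + 1)" "n = 3 * a \<or> n = 3 * a + 1 \<or> n = 3 * a + 2" for a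
      using IH[of a "2 * p"] that unfolding closes_def closes_below_def closes_above_def by auto
    from rows show ?thesis
    proof (cases rule: rows_from_3_2)
      case (1 a)
      obtain x y s t where
        A: "x \<in> row (2 * p)" "y \<in> row (2 * p)" "x + a = 2 * y" "y < a" and
        D: "s \<in> row (2 * p)" "t \<in> row (2 * p + 1)" "s + a + 1 = 2 * t" "t \<le> a"
        using IH_below[of a] 1 by blast
      \<comment> \<open>Equality \<open>v = a\<close> covers \<open>a\<close> in
        \<open>row (2 * p + 1)\<close>. It is harmless, as this is used only for
        \<open>n = 3 * a + 1\<close>, where \<open>3 * v < n\<close> and
        \<open>3 * v + 1 \<le> n\<close>.\<close>
      have "\<exists>u\<in>row (2 * p + 1). \<exists>v\<in>row (2 * p + 1). u + a = 2 * v \<and> v \<le> a"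
      proof (cases "a \<in> row (2 * p + 1)")
        case True
        then show ?thesis by force
      next
        case False
        then have "a \<in> rows_from (Suc (2 * p + 1))" using 1 rows_from_split by blast
        then have "closes (2 * p + 1) a" using IH[of a] 1 by blast
        then show ?thesis unfolding closes_def by (meson less_imp_le)
      qed
      then obtain u v where
        E: "u \<in> row (2 * p + 1)" "v \<in> row (2 * p + 1)" "u + a = 2 * v" "v \<le> a"
        by blast
      from 1(2) show ?thesis
      proof
        assume n: "n = 3 * a + 1"
        \<comment> \<open>The last digits 2, 0, 1 mix the two rows and carry 1, which is the
          relation \<open>closes_above\<close> for \<open>a\<close>.\<close>
        have "closes j n"
          using rowI(3)[OF D(1)] rowI(4)[OF D(2)] D(3,4) n j
          by (intro closesI[of "3 * s + 2" _ "3 * t"]) auto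
        moreover have "closes_below j n"
          using rowI(4)[OF E(1)] rowI(4)[OF E(2)] E(3,4) n j
          by (intro closes_belowI[of "3 * u" _ "3 * v"]) auto
        moreover have "closes_above j n"
          using rowI(4)[OF E(1)] rowI(5)[OF E(2)] E(3,4) n j
          by (intro closes_aboveI[of "3 * u" _ "3 * v + 1"]) auto
        ultimately show ?thesis by blast
      next
        assume n: "n = 3 * a + 2"
        have "closes j n"
          using rowI(3)[OF A(1)] rowI(3)[OF A(2)] A(3,4) n j
          by (intro closesI[of "3 * x + 2" _ "3 * y + 2"]) auto
        moreover have "closes_below j n"
          using rowI(3)[OF D(1)] rowI(4)[OF D(2)] D(3,4) n j
          by (intro closes_belowI[of "3 * s + 2" _ "3 * t"]) auto
        moreover have "closes_above j n"
          using rowI(3)[OF D(1)] rowI(5)[OF D(2)] D(3,4) n j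
          by (intro closes_aboveI[of "3 * s + 2" _ "3 * t + 1"]) auto
        ultimately show ?thesis by blast
      qed
    next
      case (2 a)
      have "closes (2 * p + 1) a" "closes_below (2 * p + 1) a"
        using IH[of a "2 * p + 1"] 2 by auto
      then obtain x y s t where
        A: "x \<in> row (2 * p + 1)" "y \<in> row (2 * p + 1)" "x + a = 2 * y" "y < a" and
        B: "s \<in> row (2 * p + 1)" "t \<in> row (2 * p + 1)" "s + a = 2 * t + 1" "t < a"
        unfolding closes_def closes_below_def by auto
      \<comment> \<open>Digit 2 in row \<open>j\<close> belongs to \<open>row (2 * p)\<close>, so
        the lower index is needed as well.\<close>
      obtain u v where
        E: "u \<in> row (2 * p)" "v \<in> row (2 * p)" "u + a = 2 * v + 1" "v < a"
        using IH_below(2)[of a] 2 mono by blast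
      have "closes j n"
        using rowI(4)[OF A(1)] rowI(4)[OF A(2)] A(3,4) 2 j
        by (intro closesI[of "3 * x" _ "3 * y"]) auto
      moreover have "closes_below j n"
        using rowI(3)[OF E(1)] rowI(3)[OF E(2)] E(3,4) 2 j
        by (intro closes_belowI[of "3 * u + 2" _ "3 * v + 2"]) auto
      moreover have "closes_above j n"
        using rowI(4)[OF B(1)] rowI(6)[OF B(2)] B(3,4) 2 j
        by (intro closes_aboveI[of "3 * s" _ "3 * t + 2"]) auto
      ultimately show ?thesis by blast
    qed
  next
    case j: (3 p)
    \<comment> \<open>At a multiple of 3 the higher part has index \<open>2 * p + 2\<close> for
      every last digit, so one instance of the induction hypothesis suffices.\<close>
    have "Suc j = 3 * (p + 1)" using j by simp
    with less.prems have "n \<in> rows_from (3 * (p + 1))" by metis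
    then obtain a where a: "a \<in> rows_from (2 * p + 2)" "n = 3 * a \<or> n = 3 * a + 1 \<or> n = 3 * a + 2"
      by (rule rows_from_3) simp
    then have "closes (2 * p + 1) a" "closes_below (2 * p + 1) a" "closes_above (2 * p + 1) a"
      using IH[of a "2 * p + 1"] by auto
    then obtain x y u v s t where
      A: "x \<in> row (2 * p + 1)" "y \<in> row (2 * p + 1)" "x + a = 2 * y" "y < a" and
      B: "u \<in> row (2 * p + 1)" "v \<in> row (2 * p + 1)" "u + a = 2 * v + 1" "v < a" and
      D: "s \<in> row (2 * p + 1)" "t \<in> row (2 * p + 2)" "s + a + 1 = 2 * t" "t \<le> a"
      unfolding closes_def closes_below_def closes_above_def by auto
    have Suc_j: "Suc j = 3 * p + 3" using j by simp
    from a(2) show ?thesis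
    proof (elim disjE)
      assume n: "n = 3 * a"
      have "closes j n"
        using rowI(6)[OF A(1)] rowI(5)[OF A(2)] A(3,4) n j
        by (intro closesI[of "3 * x + 2" _ "3 * y + 1"]) auto
      moreover have "closes_below j n"
        using rowI(6)[OF B(1)] rowI(6)[OF B(2)] B(3,4) n j
        by (intro closes_belowI[of "3 * u + 2" _ "3 * v + 2"]) auto
      moreover have "closes_above j n"
        using rowI(6)[OF D(1), folded j] rowI(7)[OF D(2), folded Suc_j] D(3,4) n
        by (intro closes_aboveI[of "3 * s + 2" _ "3 * t"]) auto
      ultimately show ?thesis by blast
    next
      assume n: "n = 3 * a + 1"
      have "closes j n"
        using rowI(5)[OF A(1)] rowI(5)[OF A(2)] A(3,4) n j
        by (intro closesI[of "3 * x + 1" _ "3 * y + 1"]) auto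
      moreover have "closes_below j n"
        using rowI(6)[OF A(1)] rowI(5)[OF A(2)] A(3,4) n j
        by (intro closes_belowI[of "3 * x + 2" _ "3 * y + 1"]) auto
      moreover have "closes_above j n"
        using rowI(5)[OF D(1), folded j] rowI(7)[OF D(2), folded Suc_j] D(3,4) n
        by (intro closes_aboveI[of "3 * s + 1" _ "3 * t"]) auto
      ultimately show ?thesis by blast
    next
      assume n: "n = 3 * a + 2"
      have "closes j n"
        using rowI(6)[OF A(1)] rowI(6)[OF A(2)] A(3,4) n j
        by (intro closesI[of "3 * x + 2" _ "3 * y + 2"]) auto
      moreover have "closes_below j n"
        using rowI(5)[OF A(1)] rowI(5)[OF A(2)] A(3,4) n j
        by (intro closes_belowI[of "3 * x + 1" _ "3 * y + 1"]) auto
      moreover have "closes_above j n"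
        using rowI(6)[OF D(1), folded j] rowI(8)[OF D(2), folded Suc_j] D(3,4) n
        by (intro closes_aboveI[of "3 * s + 2" _ "3 * t + 1"]) auto
      ultimately show ?thesis by blast
    qed
  qed
qed

section \<open>The greedy sequences\<close>

lemma three_free_subset: "three_free B \<Longrightarrow> A \<subseteq> B \<Longrightarrow> three_free A"
  unfolding three_free_def by blast

text \<open>The terms chosen before stage \<open>k\<close> are the \<open>k\<close> smallest
  elements of \<open>A\<close>. The next element is admissible, while a smaller candidate outside
  \<open>A\<close> would complete a progression with two terms already chosen.\<close>

lemma range_greedy_seq:
  assumes inf: "infinite A" and free: "three_free A" and disj: "A \<inter> U = {}"
    and blocked: "\<And>n. n \<notin> U \<Longrightarrow> n \<notin> A \<Longrightarrow> \<exists>x\<in>A. \<exists>y\<in>A. x + n = 2 * y \<and> y < n"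
  shows "range (greedy_seq U) = A"
proof -
  have "greedy_seq U k = enumerate A k" for k
  proof (induction k rule: less_induct)
    case (less k)
    define P where "P = enumerate A ` {..<k}"
    have P: "greedy_seq U ` {..<k} = P"
      unfolding P_def using less by (intro image_cong) auto
    have initial: "u \<in> P" if "u \<in> A" "u < enumerate A k" for u
    proof -
      obtain l where "u = enumerate A l" using enumerate_Ex[OF inf \<open>u \<in> A\<close>] by metis
      then show ?thesis using that inf by (auto simp: P_def)
    qed
    have PA: "P \<subseteq> A" using enumerate_in_set[OF inf] by (auto simp: P_def)
    have "(LEAST x. x \<notin> U \<and> (\<forall>p\<in>P. p < x) \<and> three_free (insert x P)) = enumerate A k"
    proof (rule Least_equality)
      have "insert (enumerate A k) P \<subseteq> A" using PA enumerate_in_set[OF inf] by simp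
      then show "enumerate A k \<notin> U \<and> (\<forall>p\<in>P. p < enumerate A k) \<and> three_free (insert (enumerate A k) P)"
        using three_free_subset[OF free] disj inf by (auto simp: P_def)
    next
      fix n
      assume n: "n \<notin> U \<and> (\<forall>p\<in>P. p < n) \<and> three_free (insert n P)"
      show "enumerate A k \<le> n"
      proof (rule ccontr)
        assume "\<not> enumerate A k \<le> n"
        then have lt: "n < enumerate A k" by simp
        then have "n \<notin> A" using initial n by blast
        then obtain x y where "x \<in> A" "y \<in> A" and xy: "x + n = 2 * y" "y < n"
          using blocked n by blast
        then have "x \<in> P" "y \<in> P" using initial lt by auto
        moreover have "x < y" "y - x = n - y" using xy by auto
        ultimately show False using n xy unfolding three_free_def by blast
      qed
    qed
    then show ?case by (subst greedy_seq.simps) (simp add: P)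
  qed
  then show ?thesis using range_enumerate[OF inf] by (metis ext)
qed

text \<open>\<open>stanley\<close> is strictly increasing: from an even index the last digit grows,
  from an odd one the higher part does. \<open>step ^^ i\<close> is injective.\<close>

lemma infinite_row: "infinite (row i)"
proof -
  have "strict_mono stanley"
  unfolding strict_mono_Suc_iff
  proof
    show "stanley j < stanley (Suc j)" for j
    proof (induction j rule: less_induct)
      case (less j)
      show ?case
      proof (cases "even j")
        case True
        then obtain l where "j = 2 * l" by auto
        then show ?thesis using stanley_digit[of 0 l] stanley_digit[of 1 l] by simp
      next
        case False
        then obtain l where l: "j = 2 * l + 1" by (auto elim: oddE)
        then show ?thesis
          using less[of l] stanley_digit[of 1 l] stanley_digit[of 0 "Suc l"] by simp
      qed
    qed
  qed
  then have "infinite (range stanley)"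
    using finite_imageD infinite_UNIV_nat strict_mono_imp_inj_on by blast
  then show ?thesis
    unfolding row_def using finite_imageD inj_on_subset[OF inj_step_power subset_UNIV] by blast
qed

lemma range_S: "range (S i) = row i"
proof (induction i rule: less_induct)
  case (less i)
  define U where "U = (\<Union>k<i. row k)"
  have U: "n \<notin> U \<longleftrightarrow> n \<in> rows_from i" for n
    unfolding U_def by (rule notin_earlier_rows_iff)
  have "range (S i) = range (greedy_seq U)"
    using less by (subst S.simps) (simp add: U_def)
  also have "\<dots> = row i"
  proof (rule range_greedy_seq[OF infinite_row three_free_row])
    show "row i \<inter> U = {}" using U row_subset_rows_from by blast
  next
    fix n
    assume "n \<notin> U" "n \<notin> row i"
    then have "n \<in> rows_from (Suc i)" using U rows_from_split by blast
    then show "\<exists>x\<in>row i. \<exists>y\<in>row i. x + n = 2 * y \<and> y < n"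
      using rows_from_closes closes_def by blast
  qed
  finally show ?case .
qed

theorem theorem10:
  fixes i :: nat
  shows "{base_value (3::nat) (grid i j) | j. True} = range (S i)"
  using base_value_grid by (auto simp: range_S row_def)

end
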